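(* Let $\Gamma=(V,E)$ be a finite, undirected, weighted, connected graph with $N\ge 2$ vertices (loops allowed). Let $\lambda_{N-1}$ be the largest eigenvalue of the normalized graph Laplace operator $\Delta$ and let $\overline{h}$ be the dual Cheeger constant of $\Gamma$. Then $$2\overline{h}\le\lambda_{N-1}\le 1+\sqrt{1-(1-\overline{h})^2}.$$
   Context: The weight function $w:V\times V\to\mathbb{R}$ satisfies $w_{ij}=w_{ji}$, $w_{ij}>0$ if $i\sim j$ (i.e. $i,j$ are joined by an edge; $i=j$ allowed, a loop) and $w_{ij}=0$ otherwise. The degree is $d_i=\sum_{j}w_{ij}$; $\mathrm{vol}(U)=\sum_{i\in U}d_i$ for $U\subseteq V$; $|E(U,W)|=\sum_{k\in U,\,l\in W}w_{kl}$ for $U,W\subseteq V$. The normalized Laplace operator acts on functions $v:V\to\mathbb{R}$ by $\Delta v(i)=\frac{1}{d_i}\sum_j w_{ij}(v(i)-v(j))$; it is self-adjoint for $(u,v)_\mu=\sum_i d_iu(i)v(i)$, with eigenvalues $0=\lambda_0<\lambda_1\le\dots\le\lambda_{N-1}$ (with multiplicity). The dual Cheeger constant is $$\overline{h}=\max_{V_1,V_2}\frac{2|E(V_1,V_2)|}{\mathrm{vol}(V_1)+\mathrm{vol}(V_2)},$$ the maximum being over all partitions of $V$ into disjoint sets $V_1,V_2,V_3$ with $V_1,V_2$ nonempty ($V_3=V\setminus(V_1\cup V_2)$ may be empty). *)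

theory Defs
  imports Complex_Main
begin

text \<open>
  Edges are stored as ordered pairs in a symmetric relation, so an undirected edge
  between distinct vertices occurs in both orientations and a loop is a pair \<open>(i, i)\<close>.
  The weight function is only constrained, and only ever evaluated, on \<open>V \<times> V\<close>.
\<close>

locale connected_weighted_graph =
  fixes V :: "'a set"
    and E :: "('a \<times> 'a) set"
    and w :: "'a \<Rightarrow> 'a \<Rightarrow> real"
  assumes finite_vertices: "finite V"
    and edges_subset: "E \<subseteq> V \<times> V"
    and edges_sym: "sym E"
    and weight_sym: "\<And>i j. i \<in> V \<Longrightarrow> j \<in> V \<Longrightarrow> w i j = w j i"
    and weight_pos: "\<And>i j. (i, j) \<in> E \<Longrightarrow> w i j > 0"
    and weight_zero: "\<And>i j. i \<in> V \<Longrightarrow> j \<in> V \<Longrightarrow> (i, j) \<notin> E \<Longrightarrow> w i j = 0"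
    and connected: "\<And>i j. i \<in> V \<Longrightarrow> j \<in> V \<Longrightarrow> (i, j) \<in> E\<^sup>*"

definition vertex_degree :: "'a set \<Rightarrow> ('a \<Rightarrow> 'a \<Rightarrow> real) \<Rightarrow> 'a \<Rightarrow> real" where
  "vertex_degree V w i = (\<Sum>j\<in>V. w i j)"

definition volume :: "'a set \<Rightarrow> ('a \<Rightarrow> 'a \<Rightarrow> real) \<Rightarrow> 'a set \<Rightarrow> real" where
  "volume V w U = (\<Sum>i\<in>U. vertex_degree V w i)"

definition edge_weight :: "('a \<Rightarrow> 'a \<Rightarrow> real) \<Rightarrow> 'a set \<Rightarrow> 'a set \<Rightarrow> real" where
  "edge_weight w U W = (\<Sum>k\<in>U. \<Sum>l\<in>W. w k l)"

definition laplace ::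
  "'a set \<Rightarrow> ('a \<Rightarrow> 'a \<Rightarrow> real) \<Rightarrow> ('a \<Rightarrow> real) \<Rightarrow> 'a \<Rightarrow> real" where
  "laplace V w v i = 1 / vertex_degree V w i * (\<Sum>j\<in>V. w i j * (v i - v j))"

text \<open>
  A function on \<open>V\<close> is represented by a total function whose values outside \<open>V\<close>
  are irrelevant; hence both the eigenvalue equation and the requirement of being
  nonzero are restricted to \<open>V\<close>.
\<close>

definition laplace_eigenvalue :: "'a set \<Rightarrow> ('a \<Rightarrow> 'a \<Rightarrow> real) \<Rightarrow> real \<Rightarrow> bool" where
  "laplace_eigenvalue V w ev \<longleftrightarrow>
     (\<exists>v. (\<exists>i\<in>V. v i \<noteq> 0) \<and> (\<forall>i\<in>V. laplace V w v i = ev * v i))"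

definition largest_laplace_eigenvalue :: "'a set \<Rightarrow> ('a \<Rightarrow> 'a \<Rightarrow> real) \<Rightarrow> real" where
  "largest_laplace_eigenvalue V w = Max {ev. laplace_eigenvalue V w ev}"

definition dual_cheeger :: "'a set \<Rightarrow> ('a \<Rightarrow> 'a \<Rightarrow> real) \<Rightarrow> real" where
  "dual_cheeger V w =
     Max {2 * edge_weight w V1 V2 / (volume V w V1 + volume V w V2) | V1 V2 V3.
            V1 \<union> V2 \<union> V3 = V \<and> V1 \<inter> V2 = {} \<and> V1 \<inter> V3 = {} \<and> V2 \<inter> V3 = {} \<and>
            V1 \<noteq> {} \<and> V2 \<noteq> {}}"

end

theory Submission
  imports Defs "HOL-Analysis.Function_Topology" "HOL-Analysis.Convex"
begin

text \<open>
  The largest eigenvalue is the maximum of the Rayleigh quotient. Testing it with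
  \<open>1\<close> on \<open>V1\<close>, \<open>- 1\<close> on \<open>V2\<close> and \<open>0\<close> elsewhere gives the lower bound.

  For the upper bound take an eigenfunction \<open>u\<close> of degree norm 1 and call a pair of vertices
  opposite if \<open>u\<close> has opposite nonzero signs on it. Decomposing \<open>u\<^sup>2\<close> into its level
  sets, each split by the sign of \<open>u\<close>, shows that the sum of \<open>w i j * min ((u i)\<^sup>2) ((u j)\<^sup>2)\<close>
  over opposite pairs is at most the dual Cheeger constant \<open>h\<close>. Hence \<open>2 * (1 - h)\<close> is at most
  the sum of \<open>w i j * a i j * b i j\<close>, where \<open>a i j = \<bar>u i + u j\<bar>\<close> and
  \<open>b i j = \<bar>u i - u j\<bar>\<close> for opposite pairs, and both are \<open>sqrt ((u i)\<^sup>2 + (u j)\<^sup>2)\<close>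
  otherwise. The weighted sums \<open>2 * p\<close> of \<open>a\<^sup>2\<close> and \<open>2 * q\<close> of \<open>b\<^sup>2\<close> satisfy
  \<open>p + q = 2\<close>, and \<open>p\<close> is at most 2 minus the eigenvalue, so the Cauchy--Schwarz inequality
  \<open>(1 - h)\<^sup>2 \<le> p * q\<close> yields the claim.
\<close>

section \<open>Double sums and level sets\<close>

lemma sum_sum_restrict:
  fixes f :: "'a \<Rightarrow> 'b \<Rightarrow> 'c :: comm_monoid_add"
  assumes "finite V" "finite V'" "U \<subseteq> V" "W \<subseteq> V'"
  shows "(\<Sum>i\<in>V. \<Sum>j\<in>V'. if i \<in> U then if j \<in> W then f i j else 0 else 0) = (\<Sum>i\<in>U. \<Sum>j\<in>W. f i j)"
proof -
  have "(\<Sum>i\<in>V. \<Sum>j\<in>V'. if i \<in> U then if j \<in> W then f i j else 0 else 0)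
      = (\<Sum>i\<in>V. if i \<in> U then \<Sum>j\<in>W. f i j else 0)"
    using assms by (intro sum.cong refl) (simp add: sum.inter_restrict[symmetric] Int_absorb1)
  then show ?thesis
    using assms by (simp add: sum.inter_restrict[symmetric] Int_absorb1)
qed

text \<open>Layer-cake summation: peel off the minimum of \<open>f\<close> on its support and induct on the support.\<close>

lemma sum_min_level_sets_le:
  fixes a :: "'a \<Rightarrow> 'a \<Rightarrow> real" and b f :: "'a \<Rightarrow> real"
  assumes "finite V"
    and level: "\<And>T. T \<subseteq> V \<Longrightarrow> (\<Sum>i\<in>T. \<Sum>j\<in>T. a i j) \<le> (\<Sum>i\<in>T. b i)"
    and "\<And>i. i \<in> V \<Longrightarrow> 0 \<le> f i"
  shows "(\<Sum>i\<in>V. \<Sum>j\<in>V. a i j * min (f i) (f j)) \<le> (\<Sum>i\<in>V. b i * f i)"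
  using assms(3)
proof (induction "card {i\<in>V. f i \<noteq> 0}" arbitrary: f rule: less_induct)
  case less
  define T where "T = {i\<in>V. f i \<noteq> 0}"
  have T: "finite T" "T \<subseteq> V"
    using \<open>finite V\<close> by (auto simp: T_def)
  show ?case
  proof (cases "T = {}")
    case True
    then have "f i = 0" if "i \<in> V" for i
      using that by (auto simp: T_def)
    then show ?thesis by simp
  next
    case False
    define m where "m = Min (f ` T)"
    have "m \<in> f ` T"
      unfolding m_def using T False by (intro Min_in) auto
    then obtain k where k: "k \<in> T" "f k = m" by auto
    have m_le: "m \<le> f i" if "i \<in> T" for i
      unfolding m_def using T that by auto
    have "0 \<le> m"
      using k T less.prems by blast
    define g where "g = (\<lambda>i. f i - (if i \<in> T then m else 0))"
    have g0: "0 \<le> g i" if "i \<in> V" for i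
      using that m_le less.prems by (auto simp: g_def)
    have "{i\<in>V. g i \<noteq> 0} \<subset> T"
      using k by (auto simp: g_def T_def)
    then have "card {i\<in>V. g i \<noteq> 0} < card {i\<in>V. f i \<noteq> 0}"
      using T psubset_card_mono unfolding T_def[symmetric] by blast
    then have IH: "(\<Sum>i\<in>V. \<Sum>j\<in>V. a i j * min (g i) (g j)) \<le> (\<Sum>i\<in>V. b i * g i)"
      using less.hyps g0 by blast
    \<comment> \<open>If \<open>i\<close> or \<open>j\<close> lies outside \<open>T\<close>, both
      minima are 0, since \<open>f\<close> and \<open>g\<close> are nonnegative on \<open>V\<close>
      and vanish on \<open>V\<close> outside \<open>T\<close>.\<close>
    have min_f: "min (f i) (f j) = min (g i) (g j) + (if i \<in> T then if j \<in> T then m else 0 else 0)"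
      if "i \<in> V" "j \<in> V" for i j
      using that less.prems[of i] less.prems[of j] m_le[of i] m_le[of j] \<open>0 \<le> m\<close>
      by (auto simp: g_def T_def min_def)
    have "(\<Sum>i\<in>V. \<Sum>j\<in>V. a i j * min (f i) (f j)) =
        (\<Sum>i\<in>V. \<Sum>j\<in>V. a i j * min (g i) (g j) + (if i \<in> T then if j \<in> T then a i j * m else 0 else 0))"
      by (intro sum.cong refl) (auto simp: min_f distrib_left)
    also have "\<dots> = (\<Sum>i\<in>V. \<Sum>j\<in>V. a i j * min (g i) (g j)) + (\<Sum>i\<in>T. \<Sum>j\<in>T. a i j) * m"
      using sum_sum_restrict[OF \<open>finite V\<close> \<open>finite V\<close> T(2) T(2), of "\<lambda>i j. a i j * m"]
      by (simp add: sum.distrib sum_distrib_right)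
    also have "\<dots> \<le> (\<Sum>i\<in>V. b i * g i) + (\<Sum>i\<in>T. b i) * m"
      using IH level[OF T(2)] \<open>0 \<le> m\<close> by (intro add_mono mult_right_mono)
    also have "(\<Sum>i\<in>T. b i) * m = (\<Sum>i\<in>V. if i \<in> T then b i * m else 0)"
      using \<open>finite V\<close> T by (simp add: sum.inter_restrict[symmetric] Int_absorb1 sum_distrib_right)
    also have "(\<Sum>i\<in>V. b i * g i) + \<dots> = (\<Sum>i\<in>V. b i * f i)"
      unfolding sum.distrib[symmetric]
      by (intro sum.cong refl) (auto simp: g_def algebra_simps)
    finally show ?thesis .
  qed
qed

section \<open>The degree inner product and the Dirichlet form\<close>

definition degree_inner ::
  "'a set \<Rightarrow> ('a \<Rightarrow> 'a \<Rightarrow> real) \<Rightarrow> ('a \<Rightarrow> real) \<Rightarrow> ('a \<Rightarrow> real) \<Rightarrow> real" where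
  "degree_inner V w u v = (\<Sum>i\<in>V. vertex_degree V w i * u i * v i)"

text \<open>Halving compensates for counting each edge in both orientations; loops contribute
  nothing. By \<open>laplace_green\<close> below, this is the quadratic form of the
  Laplacian.\<close>

definition dirichlet_form ::
  "'a set \<Rightarrow> ('a \<Rightarrow> 'a \<Rightarrow> real) \<Rightarrow> ('a \<Rightarrow> real) \<Rightarrow> ('a \<Rightarrow> real) \<Rightarrow> real" where
  "dirichlet_form V w u v = (\<Sum>i\<in>V. \<Sum>j\<in>V. w i j * (u i - u j) * (v i - v j)) / 2"

lemma degree_inner_commute: "degree_inner V w u v = degree_inner V w v u"
  by (simp add: degree_inner_def mult_ac)

lemma dirichlet_form_commute: "dirichlet_form V w u v = dirichlet_form V w v u"
  by (simp add: dirichlet_form_def mult_ac)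

lemma degree_inner_add_scaled:
  "degree_inner V w (\<lambda>i. u i + t * v i) (\<lambda>i. u i + t * v i) =
    degree_inner V w u u + 2 * t * degree_inner V w u v + t\<^sup>2 * degree_inner V w v v"
  unfolding degree_inner_def sum_distrib_left sum.distrib[symmetric]
  by (intro sum.cong refl) (simp add: algebra_simps power2_eq_square)

lemma dirichlet_form_add_scaled:
  "dirichlet_form V w (\<lambda>i. u i + t * v i) (\<lambda>i. u i + t * v i) =
    dirichlet_form V w u u + 2 * t * dirichlet_form V w u v + t\<^sup>2 * dirichlet_form V w v v"
  unfolding dirichlet_form_def sum_distrib_left sum.distrib[symmetric] times_divide_eq_right
    add_divide_distrib[symmetric]
  by (intro arg_cong2[where f = "(/)"] sum.cong refl) (simp add: algebra_simps power2_eq_square)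

lemma degree_inner_indicator:
  assumes "finite V" "k \<in> V"
  shows "degree_inner V w u (\<lambda>i. if i = k then 1 else 0) = vertex_degree V w k * u k"
  unfolding degree_inner_def using assms by (simp add: if_distrib cong: if_cong)

lemma degree_inner_scale:
  "degree_inner V w (\<lambda>i. c * u i) (\<lambda>i. c * v i) = c\<^sup>2 * degree_inner V w u v"
  by (simp add: degree_inner_def sum_distrib_left power2_eq_square mult_ac)

lemma dirichlet_form_scale:
  "dirichlet_form V w (\<lambda>i. c * u i) (\<lambda>i. c * v i) = c\<^sup>2 * dirichlet_form V w u v"
proof -
  have "w i j * (c * u i - c * u j) * (c * v i - c * v j) = c\<^sup>2 * (w i j * (u i - u j) * (v i - v j))" for i j
    by (simp add: algebra_simps power2_eq_square)
  then show ?thesis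
    by (simp only: dirichlet_form_def sum_distrib_left times_divide_eq_right)
qed

lemma degree_inner_normalize:
  assumes "0 < degree_inner V w v v" "c = 1 / sqrt (degree_inner V w v v)"
  shows "degree_inner V w (\<lambda>i. c * v i) (\<lambda>i. c * v i) = 1"
  unfolding degree_inner_scale using assms by (simp add: power_divide)

text \<open>Near 0 the linear term dominates, so a nonzero \<open>b\<close> would produce a negative
  value at a small \<open>t\<close> of opposite sign.\<close>

lemma nonneg_quadratic_imp_linear_coeff_zero:
  fixes b c :: real
  assumes nonneg: "\<And>t. 0 \<le> 2 * t * b + t\<^sup>2 * c"
  shows "b = 0"
proof (rule ccontr)
  assume "b \<noteq> 0"
  \<comment> \<open>\<open>C\<close> bounds \<open>c\<close> and is positive even if
    \<open>c \<le> 0\<close>, so one may take \<open>t = - b / C\<close>; the value there is at most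
    \<open>- (b\<^sup>2 / C)\<close>.\<close>
  define C where "C = \<bar>c\<bar> + 1"
  have C: "C > 0" "c \<le> C" by (auto simp: C_def)
  have "0 \<le> 2 * (- b / C) * b + (- b / C)\<^sup>2 * c"
    by (rule nonneg)
  also have "\<dots> \<le> 2 * (- b / C) * b + (- b / C)\<^sup>2 * C"
    using C by (intro add_left_mono mult_left_mono) auto
  also have "\<dots> = - (b\<^sup>2 / C)"
    using C by (simp add: power2_eq_square field_simps)
  also have "\<dots> < 0"
    using C \<open>b \<noteq> 0\<close> by simp
  finally show False by simp
qed

section \<open>Positive degrees and Green's formula\<close>

context connected_weighted_graph
begin

lemma weight_nonneg: "i \<in> V \<Longrightarrow> j \<in> V \<Longrightarrow> 0 \<le> w i j"
  using weight_pos[of i j] weight_zero[of i j] by fastforce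

text \<open>Connectedness gives a path from \<open>i\<close> to a second vertex, and its first edge,
  possibly a loop, has positive weight.\<close>

lemma vertex_degree_pos:
  assumes "card V \<ge> 2" "i \<in> V"
  shows "0 < vertex_degree V w i"
proof -
  obtain k where k: "k \<in> V" "k \<noteq> i"
    using assms by (metis card_le_Suc0_iff_eq finite_vertices not_less_eq_eq numeral_2_eq_2)
  then obtain j where j: "(i, j) \<in> E"
    using connected[OF assms(2) k(1)] by (metis converse_rtranclE)
  then have "j \<in> V" "0 < w i j"
    using edges_subset weight_pos by auto
  then show ?thesis
    unfolding vertex_degree_def using finite_vertices assms(2)
    by (intro sum_pos2[of V j]) (auto intro: weight_nonneg)
qed

lemma vertex_degree_nonneg: "i \<in> V \<Longrightarrow> 0 \<le> vertex_degree V w i"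
  by (auto simp: vertex_degree_def intro!: sum_nonneg weight_nonneg)

lemma sum_weight_left: "(\<Sum>i\<in>V. \<Sum>j\<in>V. w i j * f i) = (\<Sum>i\<in>V. vertex_degree V w i * f i)"
  by (simp add: vertex_degree_def sum_distrib_right)

lemma sum_weight_right: "(\<Sum>i\<in>V. \<Sum>j\<in>V. w i j * f j) = (\<Sum>i\<in>V. vertex_degree V w i * f i)"
proof -
  have "(\<Sum>i\<in>V. \<Sum>j\<in>V. w i j * f j) = (\<Sum>j\<in>V. \<Sum>i\<in>V. w j i * f j)"
    by (subst sum.swap) (auto intro!: sum.cong simp: weight_sym)
  then show ?thesis
    by (simp add: sum_weight_left)
qed

text \<open>The degree cancels the denominator of the Laplacian; averaging the resulting sum with
  its copy under the exchange of \<open>i\<close> and \<open>j\<close> symmetrises it.\<close>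

lemma laplace_green:
  assumes "card V \<ge> 2"
  shows "degree_inner V w (laplace V w u) v = dirichlet_form V w u v"
proof -
  have "degree_inner V w (laplace V w u) v = (\<Sum>i\<in>V. \<Sum>j\<in>V. w i j * (u i - u j) * v i)"
    unfolding degree_inner_def laplace_def
    using vertex_degree_pos[OF assms]
    by (intro sum.cong refl) (simp add: sum_distrib_right less_imp_neq[symmetric])
  moreover have "(\<Sum>i\<in>V. \<Sum>j\<in>V. w i j * (u i - u j) * v i) =
      (\<Sum>i\<in>V. \<Sum>j\<in>V. - (w i j * (u i - u j) * v j))"
    by (subst sum.swap) (auto intro!: sum.cong simp: weight_sym algebra_simps)
  moreover have "(\<Sum>i\<in>V. \<Sum>j\<in>V. w i j * (u i - u j) * v i) +
      (\<Sum>i\<in>V. \<Sum>j\<in>V. - (w i j * (u i - u j) * v j)) = 2 * dirichlet_form V w u v"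
    unfolding dirichlet_form_def sum.distrib[symmetric]
    by (simp add: algebra_simps)
  ultimately show ?thesis by linarith
qed

lemma degree_inner_nonneg: "0 \<le> degree_inner V w v v"
  by (auto simp: degree_inner_def mult.assoc intro!: sum_nonneg mult_nonneg_nonneg[OF vertex_degree_nonneg])

text \<open>Serves both for definiteness and as a coordinate bound on the unit sphere.\<close>

lemma degree_inner_term_le:
  assumes "i \<in> V"
  shows "vertex_degree V w i * (v i)\<^sup>2 \<le> degree_inner V w v v"
  unfolding degree_inner_def using finite_vertices assms
  by (subst sum.remove[of V i])
    (auto simp: power2_eq_square mult.assoc intro!: sum_nonneg mult_nonneg_nonneg[OF vertex_degree_nonneg])

lemma degree_inner_pos:
  assumes "card V \<ge> 2" "i \<in> V" "v i \<noteq> 0"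
  shows "0 < degree_inner V w v v"
proof -
  have "0 < vertex_degree V w i * (v i)\<^sup>2"
    using vertex_degree_pos assms by simp
  then show ?thesis
    using degree_inner_term_le[OF assms(2), of v] by linarith
qed

lemma eigenfunction_form:
  assumes "card V \<ge> 2" "\<And>i. i \<in> V \<Longrightarrow> laplace V w u i = ev * u i"
  shows "dirichlet_form V w u v = ev * degree_inner V w u v"
  unfolding laplace_green[OF assms(1), symmetric] degree_inner_def sum_distrib_left
  by (intro sum.cong refl) (simp add: assms(2))

section \<open>The largest eigenvalue as the maximum of the Rayleigh quotient\<close>

text \<open>The continuous form attains its maximum on the compact unit sphere, and homogeneity
  extends the bound to all functions.\<close>

lemma dirichlet_form_maximum:
  assumes card: "card V \<ge> 2"
  obtains u where "degree_inner V w u u = 1"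
    "\<And>v. dirichlet_form V w v v \<le> dirichlet_form V w u u * degree_inner V w v v"
proof -
  define r where "r i = 1 / sqrt (vertex_degree V w i)" for i
  \<comment> \<open>Freezing the values outside \<open>V\<close> at 0 makes the box a product of
    compact sets, hence compact by Tychonoff even over an infinite type. \<open>r i\<close> bounds
    the value at \<open>i\<close> of a function of norm 1.\<close>
  define B where "B = PiE UNIV (\<lambda>i. if i \<in> V then {- r i .. r i} else {0})"
  define S where "S = B \<inter> {v. degree_inner V w v v = 1}"
  have cont: "continuous_on UNIV (\<lambda>v. degree_inner V w v v)"
    unfolding degree_inner_def by (intro continuous_intros continuous_on_product_coordinates)
  have "compact B"
  proof -
    have "compactin (product_topology (\<lambda>i. euclidean) UNIV) B"
      unfolding B_def by (subst compactin_PiE) auto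
    then show ?thesis
      by (simp add: euclidean_product_topology)
  qed
  moreover have "closed {v. degree_inner V w v v = 1}"
    by (intro closed_Collect_eq cont continuous_on_const)
  ultimately have "compact S"
    unfolding S_def by (rule compact_Int_closed)
  \<comment> \<open>Cutting off outside \<open>V\<close> changes neither form, so any function of
    positive norm can be moved into \<open>S\<close>.\<close>
  have norm_in_S: "(\<lambda>i. c * (if i \<in> V then v i else 0)) \<in> S"
    if "c = 1 / sqrt (degree_inner V w v v)" "0 < degree_inner V w v v" for v c
  proof -
    define x where "x = (\<lambda>i. c * (if i \<in> V then v i else 0))"
    have "degree_inner V w x x = degree_inner V w (\<lambda>i. c * v i) (\<lambda>i. c * v i)"
      by (auto simp: degree_inner_def x_def intro!: sum.cong)
    also have "\<dots> = 1"
      using degree_inner_normalize that by blast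
    finally have x1: "degree_inner V w x x = 1" .
    have "\<bar>x i\<bar> \<le> r i" if "i \<in> V" for i
    proof -
      have d: "0 < vertex_degree V w i"
        using vertex_degree_pos card that by blast
      then have "(x i)\<^sup>2 \<le> 1 / vertex_degree V w i"
        using degree_inner_term_le[OF that, of x] x1 by (simp add: field_simps)
      then have "sqrt ((x i)\<^sup>2) \<le> sqrt (1 / vertex_degree V w i)"
        by (rule real_sqrt_le_mono)
      then show ?thesis
        by (simp add: r_def real_sqrt_divide)
    qed
    then have "x \<in> B"
      by (auto simp: B_def x_def abs_le_iff minus_le_iff)
    then show ?thesis
      using x1 by (simp add: S_def x_def)
  qed
  obtain k where k: "k \<in> V"
    using card by fastforce
  have "0 < degree_inner V w (\<lambda>i. 1) (\<lambda>i. 1)"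
    using degree_inner_pos[OF card k, of "\<lambda>i. 1"] by simp
  then have "S \<noteq> {}"
    using norm_in_S by blast
  moreover have "continuous_on S (\<lambda>v. dirichlet_form V w v v)"
    unfolding dirichlet_form_def
    by (rule continuous_on_subset[OF _ subset_UNIV])
      (intro continuous_intros continuous_on_product_coordinates, simp)
  ultimately obtain u where u: "u \<in> S" "\<And>v. v \<in> S \<Longrightarrow> dirichlet_form V w v v \<le> dirichlet_form V w u u"
    using continuous_attains_sup[OF \<open>compact S\<close>, of "\<lambda>v. dirichlet_form V w v v"] by auto
  have "dirichlet_form V w v v \<le> dirichlet_form V w u u * degree_inner V w v v" for v
  proof (cases "\<exists>i\<in>V. v i \<noteq> 0")
    case True
    then have pos: "0 < degree_inner V w v v"
      using degree_inner_pos card by blast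
    define c where "c = 1 / sqrt (degree_inner V w v v)"
    have "dirichlet_form V w (\<lambda>i. c * (if i \<in> V then v i else 0)) (\<lambda>i. c * (if i \<in> V then v i else 0))
        \<le> dirichlet_form V w u u"
      using norm_in_S[OF c_def pos] u by blast
    moreover have "dirichlet_form V w (\<lambda>i. c * (if i \<in> V then v i else 0)) (\<lambda>i. c * (if i \<in> V then v i else 0))
        = dirichlet_form V w (\<lambda>i. c * v i) (\<lambda>i. c * v i)"
      by (auto simp: dirichlet_form_def intro!: sum.cong)
    moreover have "\<dots> = dirichlet_form V w v v / degree_inner V w v v"
      unfolding dirichlet_form_scale c_def using pos by (simp add: power_divide)
    ultimately show ?thesis
      using pos by (simp add: field_simps)
  next
    case False
    then show ?thesis
      by (simp add: dirichlet_form_def degree_inner_def)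
  qed
  moreover have "degree_inner V w u u = 1"
    using u by (simp add: S_def)
  ultimately show thesis
    using that by blast
qed

text \<open>A maximiser is a critical point of the Rayleigh quotient; testing criticality with
  vertex indicators gives the eigenvalue equation pointwise.\<close>

lemma laplace_eigenvalue_maximum:
  assumes card: "card V \<ge> 2"
  obtains M where "laplace_eigenvalue V w M"
    "\<And>v. dirichlet_form V w v v \<le> M * degree_inner V w v v"
proof -
  obtain u where u: "degree_inner V w u u = 1"
    "\<And>v. dirichlet_form V w v v \<le> dirichlet_form V w u u * degree_inner V w v v"
    using dirichlet_form_maximum[OF card] by blast
  define M where "M = dirichlet_form V w u u"
  have "laplace V w u k = M * u k" if k: "k \<in> V" for k
  proof -
    define e where "e = (\<lambda>i. if i = k then 1 else 0 :: real)"
    txt \<open>The nonnegative form \<open>M * degree_inner - dirichlet_form\<close> vanishes at \<open>u\<close>,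
      so its first variation at \<open>u\<close> in direction \<open>e\<close> is 0.\<close>
    have "M * degree_inner V w u e - dirichlet_form V w u e = 0"
    proof (rule nonneg_quadratic_imp_linear_coeff_zero)
      fix t :: real
      have "0 \<le> M * degree_inner V w (\<lambda>i. u i + t * e i) (\<lambda>i. u i + t * e i) -
          dirichlet_form V w (\<lambda>i. u i + t * e i) (\<lambda>i. u i + t * e i)"
        using u(2) by (simp add: M_def)
      also have "\<dots> = 2 * t * (M * degree_inner V w u e - dirichlet_form V w u e) +
          t\<^sup>2 * (M * degree_inner V w e e - dirichlet_form V w e e)"
        unfolding degree_inner_add_scaled dirichlet_form_add_scaled u(1) M_def[symmetric]
        by (simp add: algebra_simps)
      finally show "0 \<le> 2 * t * (M * degree_inner V w u e - dirichlet_form V w u e) +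
          t\<^sup>2 * (M * degree_inner V w e e - dirichlet_form V w e e)" .
    qed
    then have "M * (vertex_degree V w k * u k) = vertex_degree V w k * laplace V w u k"
      unfolding laplace_green[OF card, symmetric] e_def
      using degree_inner_indicator[OF finite_vertices k] by simp
    then show ?thesis
      using vertex_degree_pos[OF card k] by simp
  qed
  moreover have "\<exists>i\<in>V. u i \<noteq> 0"
  proof (rule ccontr)
    assume "\<not> ?thesis"
    then have "degree_inner V w u u = 0" by (simp add: degree_inner_def)
    with u(1) show False by simp
  qed
  ultimately have "laplace_eigenvalue V w M"
    unfolding laplace_eigenvalue_def by blast
  then show thesis
    using that u(2) M_def by blast
qed

text \<open>
  Normalised eigenfunctions of distinct eigenvalues are orthonormal. Bessel's inequality for
  the indicator of each vertex, summed over all vertices, bounds their number by \<open>card V\<close>.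
\<close>

lemma finite_laplace_eigenvalues:
  assumes card: "card V \<ge> 2"
  shows "finite {ev. laplace_eigenvalue V w ev}"
proof -
  \<comment> \<open>A uniform bound on the size of finite subsets makes the whole set
    finite.\<close>
  have "card A \<le> card V" if A: "A \<subseteq> {ev. laplace_eigenvalue V w ev}" "finite A" for A
  proof -
    have "\<exists>v. degree_inner V w v v = 1 \<and> (\<forall>i\<in>V. laplace V w v i = ev * v i)" if "ev \<in> A" for ev
    proof -
      have "laplace_eigenvalue V w ev"
        using A(1) that by blast
      then obtain u where u: "\<exists>i\<in>V. u i \<noteq> 0" "\<And>i. i \<in> V \<Longrightarrow> laplace V w u i = ev * u i"
        unfolding laplace_eigenvalue_def by blast
      have pos: "0 < degree_inner V w u u"
        using u(1) degree_inner_pos[OF card] by blast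
      define c where "c = 1 / sqrt (degree_inner V w u u)"
      have "degree_inner V w (\<lambda>i. c * u i) (\<lambda>i. c * u i) = 1"
        using degree_inner_normalize[OF pos c_def] .
      moreover have "laplace V w (\<lambda>i. c * u i) i = c * laplace V w u i" for i
        by (simp add: laplace_def sum_distrib_left algebra_simps)
      ultimately show ?thesis
        using u(2) by (intro exI[of _ "\<lambda>i. c * u i"]) simp
    qed
    then obtain \<phi> where \<phi>: "\<And>ev. ev \<in> A \<Longrightarrow> degree_inner V w (\<phi> ev) (\<phi> ev) = 1"
      "\<And>ev i. ev \<in> A \<Longrightarrow> i \<in> V \<Longrightarrow> laplace V w (\<phi> ev) i = ev * \<phi> ev i"
      by metis
    have orth: "degree_inner V w (\<phi> x) (\<phi> y) = (if x = y then 1 else 0)" if "x \<in> A" "y \<in> A" for x y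
    proof -
      \<comment> \<open>By symmetry of the form both sides equal its value at the two
        eigenfunctions; distinct eigenvalues then force orthogonality.\<close>
      have "x * degree_inner V w (\<phi> x) (\<phi> y) = y * degree_inner V w (\<phi> x) (\<phi> y)"
        using eigenfunction_form[OF card \<phi>(2)] that
        by (metis degree_inner_commute dirichlet_form_commute)
      then show ?thesis
        using \<phi>(1) that by auto
    qed
    have bessel: "(\<Sum>x\<in>A. vertex_degree V w k * (\<phi> x k)\<^sup>2) \<le> 1" if k: "k \<in> V" for k
    proof -
      define d where "d = vertex_degree V w k"
      have d: "0 < d"
        using vertex_degree_pos[OF card k] by (simp add: d_def)
      define e where "e = (\<lambda>i. if i = k then 1 else 0 :: real)"
      \<comment> \<open>\<open>p\<close> is the orthogonal projection of \<open>e\<close> onto the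
        span of the \<open>\<phi> x\<close>, since \<open>d * \<phi> x k\<close> is the inner
        product of \<open>e\<close> with \<open>\<phi> x\<close>.\<close>
      define p where "p = (\<lambda>i. \<Sum>x\<in>A. d * \<phi> x k * \<phi> x i)"
      define s where "s = (\<Sum>x\<in>A. (d * \<phi> x k)\<^sup>2)"
      have ep: "degree_inner V w e p = s"
      proof -
        have "degree_inner V w e p = d * p k"
          unfolding e_def d_def
          by (subst degree_inner_commute) (rule degree_inner_indicator[OF finite_vertices k])
        then show ?thesis
          by (simp add: p_def s_def sum_distrib_left power2_eq_square mult_ac)
      qed
      have pp: "degree_inner V w p p = s"
      proof -
        have "degree_inner V w p p =
            (\<Sum>i\<in>V. \<Sum>x\<in>A. \<Sum>y\<in>A. (d * \<phi> x k) * (d * \<phi> y k) * (vertex_degree V w i * \<phi> x i * \<phi> y i))"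
          unfolding degree_inner_def p_def sum_distrib_left sum_distrib_right
          by (intro sum.cong refl) (simp add: sum_distrib_left sum_distrib_right mult_ac)
        also have "\<dots> = (\<Sum>x\<in>A. \<Sum>y\<in>A. \<Sum>i\<in>V. (d * \<phi> x k) * (d * \<phi> y k) * (vertex_degree V w i * \<phi> x i * \<phi> y i))"
          by (subst sum.swap, intro sum.cong refl, subst sum.swap, rule refl)
        also have "\<dots> = (\<Sum>x\<in>A. \<Sum>y\<in>A. (d * \<phi> x k) * (d * \<phi> y k) * degree_inner V w (\<phi> x) (\<phi> y))"
          by (simp add: degree_inner_def sum_distrib_left)
        also have "\<dots> = (\<Sum>x\<in>A. \<Sum>y\<in>A. if x = y then (d * \<phi> x k) * (d * \<phi> y k) else 0)"
          by (intro sum.cong refl) (simp add: orth)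
        also have "\<dots> = s"
          using \<open>finite A\<close> by (simp add: s_def power2_eq_square)
        finally show ?thesis .
      qed
      \<comment> \<open>The squared norm of \<open>e - p\<close> is \<open>d - s\<close>, and
        \<open>s\<close> contains a factor \<open>d\<close> that cancels.\<close>
      have "0 \<le> degree_inner V w (\<lambda>i. e i + (- 1) * p i) (\<lambda>i. e i + (- 1) * p i)"
        by (rule degree_inner_nonneg)
      also have "\<dots> = degree_inner V w e e - s"
        unfolding degree_inner_add_scaled ep pp by simp
      also have "degree_inner V w e e = d"
        unfolding e_def d_def degree_inner_indicator[OF finite_vertices k] by simp
      also have "s = d * (\<Sum>x\<in>A. d * (\<phi> x k)\<^sup>2)"
        by (simp add: s_def sum_distrib_left power2_eq_square mult_ac)
      finally show ?thesis
        using d by (simp add: d_def)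
    qed
    \<comment> \<open>The squared norms are all 1, so their sum counts \<open>A\<close>; exchanging
      the sums lets Bessel's inequality act vertex by vertex.\<close>
    have "real (card A) = (\<Sum>x\<in>A. degree_inner V w (\<phi> x) (\<phi> x))"
      by (simp add: \<phi>)
    also have "\<dots> = (\<Sum>k\<in>V. \<Sum>x\<in>A. vertex_degree V w k * (\<phi> x k)\<^sup>2)"
      unfolding degree_inner_def by (subst sum.swap) (simp add: power2_eq_square mult_ac)
    also have "\<dots> \<le> (\<Sum>k\<in>V. 1)"
      by (intro sum_mono bessel)
    finally show ?thesis by simp
  qed
  then show ?thesis
    using finite_if_finite_subsets_card_bdd by blast
qed

text \<open>Finiteness and the existence of one eigenvalue make the \<open>Max\<close>
  meaningful.\<close>

lemma largest_laplace_eigenvalue_is_eigenvalue: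
  assumes "card V \<ge> 2"
  shows "laplace_eigenvalue V w (largest_laplace_eigenvalue V w)"
proof -
  obtain M where "laplace_eigenvalue V w M"
    using laplace_eigenvalue_maximum[OF assms] by blast
  then show ?thesis
    using Max_in[OF finite_laplace_eigenvalues[OF assms]]
    unfolding largest_laplace_eigenvalue_def by blast
qed

lemma dirichlet_form_le_largest_eigenvalue:
  assumes "card V \<ge> 2"
  shows "dirichlet_form V w v v \<le> largest_laplace_eigenvalue V w * degree_inner V w v v"
proof -
  obtain M where M: "laplace_eigenvalue V w M"
    "\<And>v. dirichlet_form V w v v \<le> M * degree_inner V w v v"
    using laplace_eigenvalue_maximum[OF assms] by blast
  have "M \<le> largest_laplace_eigenvalue V w"
    unfolding largest_laplace_eigenvalue_def
    using M(1) finite_laplace_eigenvalues[OF assms] by (intro Max_ge) auto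
  then show ?thesis
    using M(2)[of v] mult_right_mono[OF _ degree_inner_nonneg] order_trans by blast
qed

section \<open>The dual Cheeger constant as an attained maximum\<close>

definition cheeger_ratio :: "'a set \<Rightarrow> 'a set \<Rightarrow> real" where
  "cheeger_ratio V1 V2 = 2 * edge_weight w V1 V2 / (volume V w V1 + volume V w V2)"

text \<open>\<open>V3\<close> is forced to be the complement of \<open>V1 \<union> V2\<close> and
  can be eliminated.\<close>

lemma dual_cheeger_Max:
  "dual_cheeger V w = Max {cheeger_ratio V1 V2 | V1 V2.
     V1 \<subseteq> V \<and> V2 \<subseteq> V \<and> V1 \<inter> V2 = {} \<and> V1 \<noteq> {} \<and> V2 \<noteq> {}}"
proof -
  have "(\<exists>V3. V1 \<union> V2 \<union> V3 = V \<and> V1 \<inter> V2 = {} \<and> V1 \<inter> V3 = {} \<and> V2 \<inter> V3 = {} \<and> V1 \<noteq> {} \<and> V2 \<noteq> {})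
      \<longleftrightarrow> V1 \<subseteq> V \<and> V2 \<subseteq> V \<and> V1 \<inter> V2 = {} \<and> V1 \<noteq> {} \<and> V2 \<noteq> {}" for V1 V2
  proof
    assume "V1 \<subseteq> V \<and> V2 \<subseteq> V \<and> V1 \<inter> V2 = {} \<and> V1 \<noteq> {} \<and> V2 \<noteq> {}"
    then show "\<exists>V3. V1 \<union> V2 \<union> V3 = V \<and> V1 \<inter> V2 = {} \<and> V1 \<inter> V3 = {} \<and> V2 \<inter> V3 = {} \<and> V1 \<noteq> {} \<and> V2 \<noteq> {}"
      by (intro exI[of _ "V - (V1 \<union> V2)"]) auto
  qed auto
  from this[symmetric] show ?thesis
    by (simp only: dual_cheeger_def cheeger_ratio_def ex_simps)
qed

lemma finite_cheeger_ratios: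
  "finite {cheeger_ratio V1 V2 | V1 V2. V1 \<subseteq> V \<and> V2 \<subseteq> V \<and> V1 \<inter> V2 = {} \<and> V1 \<noteq> {} \<and> V2 \<noteq> {}}"
proof (rule finite_subset)
  show "finite (\<Union>V1\<in>Pow V. \<Union>V2\<in>Pow V. {cheeger_ratio V1 V2})"
    using finite_vertices by simp
qed blast

lemma cheeger_ratio_le_dual_cheeger:
  assumes "V1 \<subseteq> V" "V2 \<subseteq> V" "V1 \<inter> V2 = {}" "V1 \<noteq> {}" "V2 \<noteq> {}"
  shows "cheeger_ratio V1 V2 \<le> dual_cheeger V w"
  unfolding dual_cheeger_Max using assms by (intro Max_ge finite_cheeger_ratios) blast

text \<open>Two distinct vertices give an admissible pair of singletons, so the maximum is over a
  nonempty set.\<close>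

lemma dual_cheeger_attained:
  assumes "card V \<ge> 2"
  obtains V1 V2 where "V1 \<subseteq> V" "V2 \<subseteq> V" "V1 \<inter> V2 = {}" "V1 \<noteq> {}" "V2 \<noteq> {}"
    "dual_cheeger V w = cheeger_ratio V1 V2"
proof -
  obtain i j where "i \<in> V" "j \<in> V" "i \<noteq> j"
    using assms by (metis card_le_Suc0_iff_eq finite_vertices not_less_eq_eq numeral_2_eq_2)
  then have "{cheeger_ratio V1 V2 | V1 V2. V1 \<subseteq> V \<and> V2 \<subseteq> V \<and> V1 \<inter> V2 = {} \<and> V1 \<noteq> {} \<and> V2 \<noteq> {}} \<noteq> {}"
    by (simp, intro exI[of _ "{i}"] exI[of _ "{j}"], simp)
  from Max_in[OF finite_cheeger_ratios this] show thesis
    unfolding dual_cheeger_Max[symmetric] using that by blast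
qed

lemma volume_pos:
  assumes "card V \<ge> 2" "U \<subseteq> V" "U \<noteq> {}"
  shows "0 < volume V w U"
  unfolding volume_def using assms finite_subset[OF assms(2) finite_vertices]
  by (intro sum_pos vertex_degree_pos) auto

lemma edge_weight_nonneg: "U \<subseteq> V \<Longrightarrow> W \<subseteq> V \<Longrightarrow> 0 \<le> edge_weight w U W"
  unfolding edge_weight_def by (intro sum_nonneg weight_nonneg) auto

lemma edge_weight_commute: "U \<subseteq> V \<Longrightarrow> W \<subseteq> V \<Longrightarrow> edge_weight w U W = edge_weight w W U"
  unfolding edge_weight_def by (subst sum.swap) (auto intro!: sum.cong weight_sym)

lemma edge_weight_le_volume:
  assumes "U \<subseteq> V" "W \<subseteq> V"
  shows "edge_weight w U W \<le> volume V w U"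
  unfolding edge_weight_def volume_def vertex_degree_def using assms finite_vertices
  by (intro sum_mono sum_mono2) (auto intro: weight_nonneg)

text \<open>The weight between two sets is at most the volume of either, whence the upper
  bound.\<close>

lemma dual_cheeger_bounds:
  assumes "card V \<ge> 2"
  shows "0 \<le> dual_cheeger V w" "dual_cheeger V w \<le> 1"
proof -
  obtain V1 V2 where V: "V1 \<subseteq> V" "V2 \<subseteq> V" "V1 \<inter> V2 = {}" "V1 \<noteq> {}" "V2 \<noteq> {}"
    and h: "dual_cheeger V w = cheeger_ratio V1 V2"
    by (rule dual_cheeger_attained[OF assms])
  have vol: "0 < volume V w V1" "0 < volume V w V2"
    using volume_pos[OF assms] V by auto
  have "2 * edge_weight w V1 V2 \<le> volume V w V1 + volume V w V2"
    using edge_weight_le_volume[OF V(1,2)] edge_weight_le_volume[OF V(2,1)]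
      edge_weight_commute[OF V(1,2)] by linarith
  then show "dual_cheeger V w \<le> 1"
    unfolding h cheeger_ratio_def using vol by (simp add: pos_divide_le_eq)
  show "0 \<le> dual_cheeger V w"
    unfolding h cheeger_ratio_def using vol edge_weight_nonneg V by simp
qed

text \<open>Clearing the denominator admits empty sets, which occur when a level set carries only
  one sign.\<close>

lemma edge_weight_le_dual_cheeger_volume:
  assumes "card V \<ge> 2" "V1 \<subseteq> V" "V2 \<subseteq> V" "V1 \<inter> V2 = {}"
  shows "2 * edge_weight w V1 V2 \<le> dual_cheeger V w * (volume V w V1 + volume V w V2)"
proof (cases "V1 = {} \<or> V2 = {}")
  case True
  then have "edge_weight w V1 V2 = 0"
    by (auto simp: edge_weight_def)
  moreover have "0 \<le> volume V w V1" "0 \<le> volume V w V2"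
    unfolding volume_def using assms by (auto intro!: sum_nonneg vertex_degree_nonneg)
  ultimately show ?thesis
    using dual_cheeger_bounds(1)[OF assms(1)] by simp
next
  case False
  then have "0 < volume V w V1" "0 < volume V w V2"
    using volume_pos assms by auto
  moreover have "cheeger_ratio V1 V2 \<le> dual_cheeger V w"
    using cheeger_ratio_le_dual_cheeger assms False by blast
  ultimately show ?thesis
    unfolding cheeger_ratio_def by (simp add: pos_divide_le_eq)
qed

section \<open>The lower bound\<close>

lemma dual_cheeger_lower_bound:
  assumes card: "card V \<ge> 2"
  shows "2 * dual_cheeger V w \<le> largest_laplace_eigenvalue V w"
proof -
  obtain V1 V2 where V: "V1 \<subseteq> V" "V2 \<subseteq> V" "V1 \<inter> V2 = {}" "V1 \<noteq> {}" "V2 \<noteq> {}"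
    and h: "dual_cheeger V w = cheeger_ratio V1 V2"
    by (rule dual_cheeger_attained[OF card])
  define v where "v = (\<lambda>i. if i \<in> V1 then 1 else if i \<in> V2 then - 1 else 0 :: real)"
  have vol: "0 < volume V w V1 + volume V w V2"
    using volume_pos[OF card] V by (simp add: add_pos_pos)
  have "degree_inner V w v v =
      (\<Sum>i\<in>V. (if i \<in> V1 then vertex_degree V w i else 0) + (if i \<in> V2 then vertex_degree V w i else 0))"
    unfolding degree_inner_def using V by (intro sum.cong refl) (auto simp: v_def)
  also have "\<dots> = volume V w V1 + volume V w V2"
    unfolding volume_def using V finite_vertices
    by (simp add: sum.distrib sum.inter_restrict[symmetric] Int_absorb1)
  finally have D: "degree_inner V w v v = volume V w V1 + volume V w V2" .
  have "4 * edge_weight w V1 V2 = 2 * edge_weight w V1 V2 + 2 * edge_weight w V2 V1"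
    using edge_weight_commute V by simp
  also have "\<dots> = (\<Sum>i\<in>V. \<Sum>j\<in>V. (if i \<in> V1 then if j \<in> V2 then 2 * w i j else 0 else 0) +
      (if i \<in> V2 then if j \<in> V1 then 2 * w i j else 0 else 0))"
    using sum_sum_restrict[OF finite_vertices finite_vertices V(1,2), of "\<lambda>i j. 2 * w i j"]
      sum_sum_restrict[OF finite_vertices finite_vertices V(2,1), of "\<lambda>i j. 2 * w i j"]
    by (simp add: sum.distrib edge_weight_def sum_distrib_left)
  \<comment> \<open>A pair between \<open>V1\<close> and \<open>V2\<close> contributes
    \<open>w i j * 2\<^sup>2 / 2\<close>; all other pairs contribute nonnegative amounts.\<close>
  also have "\<dots> \<le> (\<Sum>i\<in>V. \<Sum>j\<in>V. w i j * (v i - v j) * (v i - v j) / 2)"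
    using V by (intro sum_mono) (auto simp: v_def weight_nonneg)
  also have "\<dots> = dirichlet_form V w v v"
    by (simp add: dirichlet_form_def sum_divide_distrib)
  also have "\<dots> \<le> largest_laplace_eigenvalue V w * (volume V w V1 + volume V w V2)"
    using dirichlet_form_le_largest_eigenvalue[OF card, of v] D by simp
  finally show ?thesis
    unfolding h cheeger_ratio_def using vol by (simp add: pos_divide_le_eq)
qed

section \<open>The upper bound\<close>

text \<open>Layer-cake summation for \<open>(u i)\<^sup>2\<close> reduces this to the Cheeger
  inequality for the two sign classes of each vertex set.\<close>

lemma sum_opposite_min_le:
  assumes card: "card V \<ge> 2"
  shows "(\<Sum>i\<in>V. \<Sum>j\<in>V. (if u i * u j < 0 then w i j else 0) * min ((u i)\<^sup>2) ((u j)\<^sup>2))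
    \<le> dual_cheeger V w * degree_inner V w u u"
proof -
  have "(\<Sum>i\<in>V. \<Sum>j\<in>V. (if u i * u j < 0 then w i j else 0) * min ((u i)\<^sup>2) ((u j)\<^sup>2))
      \<le> (\<Sum>i\<in>V. dual_cheeger V w * vertex_degree V w i * (u i)\<^sup>2)"
  proof (rule sum_min_level_sets_le[OF finite_vertices])
    fix T assume T: "T \<subseteq> V"
    then have fin: "finite T"
      using finite_vertices finite_subset by blast
    define P where "P = {i\<in>T. 0 < u i}"
    define N where "N = {i\<in>T. u i < 0}"
    have PN: "P \<subseteq> T" "N \<subseteq> T" "P \<inter> N = {}"
      by (auto simp: P_def N_def)
    then have PNV: "P \<subseteq> V" "N \<subseteq> V"
      using T by auto
    have "(\<Sum>i\<in>T. \<Sum>j\<in>T. if u i * u j < 0 then w i j else 0)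
        = (\<Sum>i\<in>T. \<Sum>j\<in>T. (if i \<in> P then if j \<in> N then w i j else 0 else 0) +
            (if i \<in> N then if j \<in> P then w i j else 0 else 0))"
      by (intro sum.cong refl) (auto simp: P_def N_def mult_less_0_iff)
    also have "\<dots> = edge_weight w P N + edge_weight w N P"
      using sum_sum_restrict[OF fin fin PN(1,2), of w] sum_sum_restrict[OF fin fin PN(2,1), of w]
      by (simp add: sum.distrib edge_weight_def)
    also have "\<dots> = 2 * edge_weight w P N"
      using edge_weight_commute PNV by simp
    also have "\<dots> \<le> dual_cheeger V w * (volume V w P + volume V w N)"
      by (rule edge_weight_le_dual_cheeger_volume[OF card PNV PN(3)])
    also have "volume V w P + volume V w N = volume V w (P \<union> N)"
      unfolding volume_def using PN fin by (intro sum.union_disjoint[symmetric]) (auto intro: finite_subset)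
    \<comment> \<open>Adding the vertices of \<open>T\<close> where \<open>u\<close> vanishes only
      enlarges the volume.\<close>
    also have "dual_cheeger V w * \<dots> \<le> dual_cheeger V w * volume V w T"
      unfolding volume_def using fin PN T
      by (intro mult_left_mono dual_cheeger_bounds[OF card] sum_mono2) (auto intro: vertex_degree_nonneg)
    finally show "(\<Sum>i\<in>T. \<Sum>j\<in>T. if u i * u j < 0 then w i j else 0)
        \<le> (\<Sum>i\<in>T. dual_cheeger V w * vertex_degree V w i)"
      by (simp add: volume_def sum_distrib_left)
  qed simp
  also have "\<dots> = dual_cheeger V w * degree_inner V w u u"
    by (simp add: degree_inner_def sum_distrib_left power2_eq_square mult_ac)
  finally show ?thesis .
qed

text \<open>\<open>p\<close> is not yet replaced by its upper bound, because
  \<open>p * (2 - p)\<close> increases only up to \<open>p = 1\<close>.\<close>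

lemma dual_cheeger_form_inequality:
  assumes card: "card V \<ge> 2"
    and D: "degree_inner V w u u = 1"
  obtains p where "p \<le> 2 - dirichlet_form V w u u" "(1 - dual_cheeger V w)\<^sup>2 \<le> p * (2 - p)"
proof -
  \<comment> \<open>In both cases \<open>(a i j)\<^sup>2 + (b i j)\<^sup>2\<close> is
    \<open>2 * ((u i)\<^sup>2 + (u j)\<^sup>2)\<close>, which gives
    \<open>p + q = 2\<close>.\<close>
  define a where "a i j = (if u i * u j < 0 then \<bar>u i + u j\<bar> else sqrt ((u i)\<^sup>2 + (u j)\<^sup>2))" for i j
  define b where "b i j = (if u i * u j < 0 then \<bar>u i - u j\<bar> else sqrt ((u i)\<^sup>2 + (u j)\<^sup>2))" for i j
  define p where "p = (\<Sum>i\<in>V. \<Sum>j\<in>V. w i j * (a i j)\<^sup>2) / 2"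
  define q where "q = (\<Sum>i\<in>V. \<Sum>j\<in>V. w i j * (b i j)\<^sup>2) / 2"
  define h where "h = dual_cheeger V w"
  define R where "R = (\<Sum>i\<in>V. \<Sum>j\<in>V. (if u i * u j < 0 then w i j else 0) * min ((u i)\<^sup>2) ((u j)\<^sup>2))"
  have sum_sq: "(\<Sum>i\<in>V. \<Sum>j\<in>V. w i j * ((u i)\<^sup>2 + (u j)\<^sup>2)) = 2"
  proof -
    have "(\<Sum>i\<in>V. vertex_degree V w i * (u i)\<^sup>2) = 1"
      using D by (simp add: degree_inner_def power2_eq_square mult_ac)
    then show ?thesis
      using sum_weight_left[of "\<lambda>i. (u i)\<^sup>2"] sum_weight_right[of "\<lambda>i. (u i)\<^sup>2"]
      by (simp add: distrib_left sum.distrib)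
  qed
  have "2 * p + 2 * q = (\<Sum>i\<in>V. \<Sum>j\<in>V. 2 * (w i j * ((u i)\<^sup>2 + (u j)\<^sup>2)))"
    unfolding p_def q_def by (simp add: sum.distrib[symmetric])
      (intro sum.cong refl, simp add: a_def b_def power2_eq_square algebra_simps)
  then have pq: "p + q = 2"
    using sum_sq by (simp add: sum_distrib_left[symmetric])
  \<comment> \<open>Opposite pairs give equality; for the others \<open>u i * u j \<ge> 0\<close>,
    so \<open>(u i)\<^sup>2 + (u j)\<^sup>2 \<le> (u i + u j)\<^sup>2\<close>.\<close>
  have "2 * p \<le> (\<Sum>i\<in>V. \<Sum>j\<in>V. w i j * (u i + u j)\<^sup>2)"
    unfolding p_def by (simp, intro sum_mono mult_left_mono weight_nonneg)
      (auto simp: a_def power2_sum not_less)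
  also have "\<dots> = 4 - 2 * dirichlet_form V w u u"
  proof -
    have "(\<Sum>i\<in>V. \<Sum>j\<in>V. w i j * (u i + u j)\<^sup>2) + 2 * dirichlet_form V w u u
        = (\<Sum>i\<in>V. \<Sum>j\<in>V. 2 * (w i j * ((u i)\<^sup>2 + (u j)\<^sup>2)))"
      unfolding dirichlet_form_def by (simp add: sum.distrib[symmetric])
        (intro sum.cong refl, simp add: power2_eq_square algebra_simps)
    then show ?thesis
      using sum_sq by (simp add: sum_distrib_left[symmetric])
  qed
  finally have p_le: "p \<le> 2 - dirichlet_form V w u u" by simp
  \<comment> \<open>The right side is \<open>\<bar>x\<^sup>2 - y\<^sup>2\<bar>\<close>, the maximum
    of the squares minus their minimum.\<close>
  have min_eq: "x\<^sup>2 + y\<^sup>2 - 2 * min (x\<^sup>2) (y\<^sup>2) = \<bar>x + y\<bar> * \<bar>x - y\<bar>" for x y :: real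
  proof -
    have "\<bar>x + y\<bar> * \<bar>x - y\<bar> = \<bar>x\<^sup>2 - y\<^sup>2\<bar>"
      by (simp add: abs_mult[symmetric] power2_eq_square algebra_simps)
    then show ?thesis by (simp add: min_def)
  qed
  have "(\<Sum>i\<in>V. \<Sum>j\<in>V. w i j * ((u i)\<^sup>2 + (u j)\<^sup>2)) - 2 * R =
      (\<Sum>i\<in>V. \<Sum>j\<in>V. w i j * (a i j * b i j))"
    unfolding R_def sum_distrib_left sum_subtractf[symmetric]
  proof (intro sum.cong refl)
    fix i j
    show "w i j * ((u i)\<^sup>2 + (u j)\<^sup>2) - 2 * ((if u i * u j < 0 then w i j else 0) * min ((u i)\<^sup>2) ((u j)\<^sup>2))
        = w i j * (a i j * b i j)"
    proof (cases "u i * u j < 0")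
      case True
      then have "a i j * b i j = (u i)\<^sup>2 + (u j)\<^sup>2 - 2 * min ((u i)\<^sup>2) ((u j)\<^sup>2)"
        by (simp add: a_def b_def min_eq)
      with True show ?thesis
        by (simp only: if_True right_diff_distrib mult.left_commute)
    qed (simp add: a_def b_def)
  qed
  moreover have "R \<le> h"
    using sum_opposite_min_le[OF card, of u] D by (simp add: R_def h_def)
  ultimately have "2 * (1 - h) \<le> (\<Sum>i\<in>V. \<Sum>j\<in>V. w i j * (a i j * b i j))"
    unfolding sum_sq by simp
  also have "\<dots> = (\<Sum>(i, j)\<in>V \<times> V. (sqrt (w i j) * a i j) * (sqrt (w i j) * b i j))"
    unfolding sum.cartesian_product
    by (intro sum.cong refl) (auto simp: weight_nonneg mult_ac)
  \<comment> \<open>Squaring preserves the inequality because \<open>h \<le> 1\<close>.\<close>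
  finally have "(2 * (1 - h))\<^sup>2 \<le> (\<Sum>(i, j)\<in>V \<times> V. (sqrt (w i j) * a i j) * (sqrt (w i j) * b i j))\<^sup>2"
    using dual_cheeger_bounds(2)[OF card] by (intro power_mono) (auto simp: h_def)
  also have "\<dots> \<le> (\<Sum>(i, j)\<in>V \<times> V. (sqrt (w i j) * a i j)\<^sup>2) * (\<Sum>(i, j)\<in>V \<times> V. (sqrt (w i j) * b i j)\<^sup>2)"
    using Cauchy_Schwarz_ineq_sum[of "\<lambda>(i, j). sqrt (w i j) * a i j" "\<lambda>(i, j). sqrt (w i j) * b i j" "V \<times> V"]
    by (simp add: case_prod_unfold)
  also have "(\<Sum>(i, j)\<in>V \<times> V. (sqrt (w i j) * a i j)\<^sup>2) = 2 * p"
    unfolding p_def sum.cartesian_product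
    by (simp, intro sum.cong refl) (auto simp: weight_nonneg power_mult_distrib)
  also have "(\<Sum>(i, j)\<in>V \<times> V. (sqrt (w i j) * b i j)\<^sup>2) = 2 * q"
    unfolding q_def sum.cartesian_product
    by (simp, intro sum.cong refl) (auto simp: weight_nonneg power_mult_distrib)
  also have "q = 2 - p"
    using pq by simp
  finally have "(1 - h)\<^sup>2 \<le> p * (2 - p)"
    by (simp add: power2_eq_square algebra_simps)
  then show thesis
    using that p_le by (simp add: h_def)
qed

text \<open>Since \<open>p * (2 - p) = 1 - (1 - p)\<^sup>2\<close>, the form inequality bounds
  \<open>1 - p\<close>, which is at least the eigenvalue minus 1.\<close>

lemma dual_cheeger_upper_bound:
  assumes card: "card V \<ge> 2"
  shows "largest_laplace_eigenvalue V w \<le> 1 + sqrt (1 - (1 - dual_cheeger V w)\<^sup>2)"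
proof -
  define ev where "ev = largest_laplace_eigenvalue V w"
  obtain u where u: "\<exists>i\<in>V. u i \<noteq> 0" "\<And>i. i \<in> V \<Longrightarrow> laplace V w u i = ev * u i"
    using largest_laplace_eigenvalue_is_eigenvalue[OF card]
    unfolding laplace_eigenvalue_def ev_def by blast
  have pos: "0 < degree_inner V w u u"
    using u(1) degree_inner_pos[OF card] by blast
  define c where "c = 1 / sqrt (degree_inner V w u u)"
  have 1: "degree_inner V w (\<lambda>i. c * u i) (\<lambda>i. c * u i) = 1"
    using degree_inner_normalize[OF pos c_def] .
  have "dirichlet_form V w (\<lambda>i. c * u i) (\<lambda>i. c * u i)
      = ev * degree_inner V w (\<lambda>i. c * u i) (\<lambda>i. c * u i)"
    using eigenfunction_form[OF card u(2)] by (simp add: degree_inner_scale dirichlet_form_scale)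
  with 1 obtain p where p: "p \<le> 2 - ev" "(1 - dual_cheeger V w)\<^sup>2 \<le> p * (2 - p)"
    using dual_cheeger_form_inequality[OF card 1] by auto
  have "ev - 1 \<le> sqrt (1 - (1 - dual_cheeger V w)\<^sup>2)"
  \<comment> \<open>Squaring \<open>ev - 1 \<le> 1 - p\<close> requires a nonnegative left side; if
    \<open>ev < 1\<close>, nonnegativity of the root suffices.\<close>
  proof (cases "1 \<le> ev")
    case True
    then have "(ev - 1)\<^sup>2 \<le> (1 - p)\<^sup>2"
      using p(1) by (intro power_mono) auto
    also have "\<dots> \<le> 1 - (1 - dual_cheeger V w)\<^sup>2"
      using p(2) by (simp add: power2_eq_square algebra_simps)
    finally show ?thesis
      by (rule real_le_rsqrt)
  next
    case False
    moreover have "(1 - dual_cheeger V w)\<^sup>2 \<le> 1"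
      using dual_cheeger_bounds[OF card] by (intro power_le_one) auto
    ultimately show ?thesis
      by (smt (verit) real_sqrt_ge_zero)
  qed
  then show ?thesis
    by (simp add: ev_def)
qed

end

theorem theorem3p2:
  fixes V :: "'a set" and E :: "('a \<times> 'a) set" and w :: "'a \<Rightarrow> 'a \<Rightarrow> real"
  assumes "connected_weighted_graph V E w"
    and "card V \<ge> 2"
  shows "2 * dual_cheeger V w \<le> largest_laplace_eigenvalue V w \<and>
         largest_laplace_eigenvalue V w \<le> 1 + sqrt (1 - (1 - dual_cheeger V w)\<^sup>2)"
  using connected_weighted_graph.dual_cheeger_lower_bound[OF assms]
    connected_weighted_graph.dual_cheeger_upper_bound[OF assms] by blast

end
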